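(* Let $X$ be a topological space. Then the following hold: (1) If $X$ is Lindelöf, then $X$ is set strongly star-Lindelöf. (2) If $X$ is countably compact, then $X$ is set strongly star-Lindelöf.
   Context: For a subset $A$ of a space $X$ and a collection $\mathcal{U}$ of subsets of $X$, put $\mathrm{St}(A,\mathcal{U})=\bigcup\{U\in\mathcal{U}: U\cap A\neq\emptyset\}$. A space $X$ is set strongly star-Lindelöf if for each nonempty subset $A$ of $X$ and each collection $\mathcal{U}$ of open sets in $X$ such that $\overline{A}\subseteq\bigcup\mathcal{U}$, there is a countable subset $F$ of $\overline{A}$ such that $A\subseteq\mathrm{St}(F,\mathcal{U})$. Lindelöf means every open cover has a countable subcover; countably compact means every countable open cover has a finite subcover. "Countable" includes finite. No separation axioms are assumed. *)

theory Defs
  imports "HOL-Analysis.Analysis"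
begin

definition St :: "'a set \<Rightarrow> 'a set set \<Rightarrow> 'a set" where
  "St A \<U> = \<Union>{U \<in> \<U>. U \<inter> A \<noteq> {}}"

definition set_strongly_star_Lindelof :: "'a topology \<Rightarrow> bool" where
  "set_strongly_star_Lindelof X \<longleftrightarrow>
     (\<forall>A \<U>. A \<noteq> {} \<and> A \<subseteq> topspace X \<and> (\<forall>U \<in> \<U>. openin X U) \<and> X closure_of A \<subseteq> \<Union>\<U>
        \<longrightarrow> (\<exists>F. countable F \<and> F \<subseteq> X closure_of A \<and> A \<subseteq> St F \<U>))"

(* The library has countable compactness only for sets over the topological_space class;
   this is the version for abstract topologies, in the form of Lindelof_space_def. *)
definition countably_compact_space :: "'a topology \<Rightarrow> bool" where
  "countably_compact_space X \<longleftrightarrow>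
     (\<forall>\<U>. countable \<U> \<and> (\<forall>U \<in> \<U>. openin X U) \<and> \<Union>\<U> = topspace X
        \<longrightarrow> (\<exists>\<V>. finite \<V> \<and> \<V> \<subseteq> \<U> \<and> \<Union>\<V> = topspace X))"

end

theory Submission
  imports Defs
begin

text \<open>For countably compact spaces, if no finite subset of \<open>A\<close> has a star containing \<open>A\<close>, then one
  can choose points of \<open>A\<close> successively, each outside the star of its predecessors. A cluster point
  of this sequence lies in some member of the cover, which then contains two terms of the sequence,
  contradicting the choice of the later one.\<close>

text \<open>The closure of \<open>A\<close> is closed, hence Lindelof, so countably many members of
  the cover suffice for it. One point of \<open>A\<close> from each of these that meets
  \<open>A\<close> gives \<open>F\<close>.\<close>

lemma Lindelof_space_imp_set_strongly_star_Lindelof: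
  assumes "Lindelof_space X"
  shows "set_strongly_star_Lindelof X"
  unfolding set_strongly_star_Lindelof_def
proof (intro allI impI)
  fix A \<U>
  assume H: "A \<noteq> {} \<and> A \<subseteq> topspace X \<and> (\<forall>U \<in> \<U>. openin X U) \<and> X closure_of A \<subseteq> \<Union>\<U>"
  then have sub: "A \<subseteq> X closure_of A" by (simp add: closure_of_subset)
  have "Lindelof_space (subtopology X (X closure_of A))"
    using assms by (simp add: Lindelof_space_closedin_subtopology)
  then obtain \<V> where \<V>: "countable \<V>" "\<V> \<subseteq> \<U>" "X closure_of A \<subseteq> \<Union>\<V>"
    using H Lindelof_space_subtopology_subset[OF closure_of_subset_topspace, of X A] by meson
  define c where "c V = (SOME x. x \<in> V \<inter> A)" for V
  define F where "F = c ` {V \<in> \<V>. V \<inter> A \<noteq> {}}"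
  have c: "c V \<in> V \<inter> A" if "V \<inter> A \<noteq> {}" for V
    using that unfolding c_def by (metis ex_in_conv someI_ex)
  have "A \<subseteq> St F \<U>"
  proof
    fix a assume "a \<in> A"
    then obtain V where "V \<in> \<V>" "a \<in> V" using sub \<V>(3) by blast
    then show "a \<in> St F \<U>"
      using c[of V] \<open>a \<in> A\<close> \<V>(2) unfolding St_def F_def by blast
  qed
  moreover have "countable F" unfolding F_def using \<V>(1) by simp
  moreover have "F \<subseteq> X closure_of A" unfolding F_def using c sub by blast
  ultimately show "\<exists>F. countable F \<and> F \<subseteq> X closure_of A \<and> A \<subseteq> St F \<U>" by blast
qed

text \<open>If no point were in the closure of every tail, the complements of these closures would
  cover the space. But a term of large enough index escapes any finitely many of them.\<close>

lemma countably_compact_space_cluster_point: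
  fixes x :: "nat \<Rightarrow> 'a"
  assumes X: "countably_compact_space X" and x: "range x \<subseteq> topspace X"
  obtains p where "\<And>n. p \<in> X closure_of (x ` {n..})"
proof (rule ccontr)
  assume no: "\<not> thesis"
  define W where "W n = topspace X - X closure_of (x ` {n..})" for n
  have "\<Union>(range W) = topspace X"
    using no that unfolding W_def by fastforce
  moreover have "openin X (W n)" for n by (simp add: W_def openin_diff)
  ultimately obtain \<V> where "finite \<V>" "\<V> \<subseteq> range W" and \<V>: "\<Union>\<V> = topspace X"
    using X[unfolded countably_compact_space_def, rule_format, of "range W"] by auto
  then obtain I where I: "finite I" "\<V> = W ` I"
    by (meson finite_subset_image)
  obtain n where n: "\<And>i. i \<in> I \<Longrightarrow> i \<le> n"
    using I(1) finite_nat_set_iff_bounded_le by auto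
  have "x n \<in> topspace X" using x by auto
  then obtain i where i: "i \<in> I" "x n \<in> W i" using \<V> I(2) by blast
  \<comment> \<open>As \<open>i \<le> n\<close>, the point \<open>x n\<close> belongs to the tail
    from \<open>i\<close>, whose closure \<open>W i\<close> omits.\<close>
  have "x ` {i..} \<subseteq> X closure_of (x ` {i..})"
    using x by (intro closure_of_subset) auto
  then show False using i n[of i] by (auto simp: W_def)
qed

lemma countably_compact_space_finite_star:
  assumes X: "countably_compact_space X" and A: "A \<subseteq> topspace X"
    and \<U>: "\<And>U. U \<in> \<U> \<Longrightarrow> openin X U" "X closure_of A \<subseteq> \<Union>\<U>"
  shows "\<exists>F. finite F \<and> F \<subseteq> A \<and> A \<subseteq> St F \<U>"
proof (rule ccontr)
  assume no: "\<not> ?thesis"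
  \<comment> \<open>The choice is meaningful for finite \<open>S \<subseteq> A\<close>: there
    \<open>no\<close> provides a witness.\<close>
  define f where "f S = (SOME a. a \<in> A - St S \<U>)" for S
  have f: "f S \<in> A - St S \<U>" if "finite S" "S \<subseteq> A" for S
  proof -
    have "\<exists>a. a \<in> A - St S \<U>" using no that by blast
    then show ?thesis unfolding f_def by (rule someI_ex)
  qed
  \<comment> \<open>The recursion builds the set of predecessors: \<open>S n\<close> consists of the
    terms \<open>x m\<close> with \<open>m < n\<close>, so \<open>S 0\<close> is empty.\<close>
  define S where "S = rec_nat {} (\<lambda>_ T. insert (f T) T)"
  define x where "x n = f (S n)" for n
  have S_Suc: "S (Suc n) = insert (x n) (S n)" for n by (simp add: S_def x_def)
  have S: "finite (S n) \<and> S n \<subseteq> A" for n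
    by (induction n) (use f in \<open>auto simp: S_def\<close>)
  have x: "x n \<in> A - St (S n) \<U>" for n using f S by (simp add: x_def)
  have mem: "x m \<in> S n" if "m < n" for m n
    using that by (induction n) (auto simp: S_Suc less_Suc_eq)
  have "range x \<subseteq> topspace X" using x A by blast
  then obtain p where p: "\<And>n. p \<in> X closure_of (x ` {n..})"
    using countably_compact_space_cluster_point[OF X] by metis
  \<comment> \<open>The cluster point may lie outside \<open>A\<close>; it is covered because the
    cover reaches the whole closure.\<close>
  have "x ` {0..} \<subseteq> A" using x by blast
  then have "p \<in> X closure_of A" using p[of 0] closure_of_mono by blast
  then obtain U where U: "U \<in> \<U>" "p \<in> U" using \<U>(2) by blast
  have hit: "\<exists>k\<ge>n. x k \<in> U" for n
    using p[of n] U \<U>(1) by (auto simp: in_closure_of)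
  obtain m where m: "x m \<in> U" using hit by blast
  \<comment> \<open>Starting at \<open>Suc m\<close> makes \<open>n\<close> strictly larger, so
    \<open>x m\<close> is in \<open>S n\<close> and \<open>U\<close> is part of the star of
    \<open>S n\<close>.\<close>
  obtain n where n: "n > m" "x n \<in> U" using hit[of "Suc m"] Suc_le_eq by blast
  then have "x n \<in> St (S n) \<U>" using m mem[of m n] U(1) unfolding St_def by blast
  then show False using x by blast
qed

lemma countably_compact_space_imp_set_strongly_star_Lindelof:
  assumes "countably_compact_space X"
  shows "set_strongly_star_Lindelof X"
  unfolding set_strongly_star_Lindelof_def
proof (intro allI impI)
  fix A \<U>
  assume "A \<noteq> {} \<and> A \<subseteq> topspace X \<and> (\<forall>U \<in> \<U>. openin X U) \<and> X closure_of A \<subseteq> \<Union>\<U>"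
  moreover from this obtain F where "finite F" "F \<subseteq> A" "A \<subseteq> St F \<U>"
    using countably_compact_space_finite_star[OF assms] by metis
  ultimately show "\<exists>F. countable F \<and> F \<subseteq> X closure_of A \<and> A \<subseteq> St F \<U>"
    by (meson closure_of_subset countable_finite order_trans)
qed

theorem theorem2p2:
  fixes X :: "'a topology"
  shows "(Lindelof_space X \<longrightarrow> set_strongly_star_Lindelof X) \<and>
         (countably_compact_space X \<longrightarrow> set_strongly_star_Lindelof X)"
  using Lindelof_space_imp_set_strongly_star_Lindelof
    countably_compact_space_imp_set_strongly_star_Lindelof by blast

end
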